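(* Consider a system $$u\mapsto Bu+g(u,v),\qquad v\mapsto Cv+h(u,v),\qquad u\in\mathbb{R}^m,\ v\in\mathbb{R}^{N-m},$$ with a nonhyperbolic fixed point $\mathbf{x}_0=0$, where the matrix $B$ has $m$ multipliers on the unit circle and the matrix $C$ has $N-m$ multipliers inside the unit circle. Let the center manifold be given by $v=V(u)$, where $V:\mathbb{R}^m\to\mathbb{R}^{N-m}$ is of class $C^r$, $r\ge1$. If an orbit $S(u_1)=(u_n)_{n\in\mathbb{N}}$ of the $m$-dimensional system $u\mapsto Bu+g(u,V(u))$ has box dimension $\dim_BS(u_1)=D$, then the corresponding orbit $\{(u_n,V(u_n)):n\in\mathbb{N}\}$ of the full system on the center manifold has box dimension $D$.
   Context: The multipliers are the eigenvalues of $B$ and $C$ (so $B$ is $m\times m$ with all eigenvalues on the unit circle, $C$ is $(N-m)\times(N-m)$ with all eigenvalues inside it). The functions $g$ and $h$ are smooth with Taylor expansions at the origin starting with at least quadratic terms. The center manifold is locally the graph of $V$, with $V(u)=\mathcal{O}(\|u\|^2)$; orbits considered are bounded and lie in the neighbourhood of the origin where the graph of $V$ is invariant. An orbit is identified with its set of points. Box dimension: for a bounded set $A\subset\mathbb{R}^N$ let $A_\varepsilon=\{y\in\mathbb{R}^N: d(y,A)<\varepsilon\}$ and let $|A_\varepsilon|$ be its Lebesgue measure. For $s\ge 0$ put $\mathcal{M}_*^s(A)=\liminf_{\varepsilon\to0}|A_\varepsilon|/\varepsilon^{N-s}$ and $\mathcal{M}^{*s}(A)=\limsup_{\varepsilon\to0}|A_\varepsilon|/\varepsilon^{N-s}$.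 The lower and upper box dimensions are $\underline{\dim}_B A=\inf\{s>0:\mathcal{M}_*^s(A)=0\}$ and $\overline{\dim}_B A=\inf\{s>0:\mathcal{M}^{*s}(A)=0\}$; if they coincide, the common value is denoted $\dim_B A$. The assertion $\dim_B A=d$ includes that both coincide. *)

theory Defs
  imports "HOL-Analysis.Analysis" "HOL-Library.Landau_Symbols"
begin

text \<open>Box dimension. Since \<open>infdist y {} = 0\<close> in the library, the empty set is treated
  separately, so that its neighbourhoods are empty (that is, \<open>d(y, {}) = \<infinity>\<close>).\<close>

definition eps_nbhd :: "'a::euclidean_space set \<Rightarrow> real \<Rightarrow> 'a set" where
  "eps_nbhd A \<epsilon> = {y. A \<noteq> {} \<and> infdist y A < \<epsilon>}"

definition lower_minkowski_content :: "real \<Rightarrow> 'a::euclidean_space set \<Rightarrow> ennreal" where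
  "lower_minkowski_content s A =
     Liminf (at_right 0)
       (\<lambda>\<epsilon>. emeasure lebesgue (eps_nbhd A \<epsilon>) / ennreal (\<epsilon> powr (real DIM('a) - s)))"

definition upper_minkowski_content :: "real \<Rightarrow> 'a::euclidean_space set \<Rightarrow> ennreal" where
  "upper_minkowski_content s A =
     Limsup (at_right 0)
       (\<lambda>\<epsilon>. emeasure lebesgue (eps_nbhd A \<epsilon>) / ennreal (\<epsilon> powr (real DIM('a) - s)))"

text \<open>For bounded \<open>A\<close> the sets below contain every \<open>s > DIM('a)\<close>, so the infima are taken over
  nonempty sets bounded below by \<open>0\<close>.\<close>

definition lower_box_dim :: "'a::euclidean_space set \<Rightarrow> real" where
  "lower_box_dim A = Inf {s. s > 0 \<and> lower_minkowski_content s A = 0}"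

definition upper_box_dim :: "'a::euclidean_space set \<Rightarrow> real" where
  "upper_box_dim A = Inf {s. s > 0 \<and> upper_minkowski_content s A = 0}"

definition has_box_dim :: "'a::euclidean_space set \<Rightarrow> real \<Rightarrow> bool" where
  "has_box_dim A d \<longleftrightarrow> bounded A \<and> lower_box_dim A = d \<and> upper_box_dim A = d"

text \<open>On an open set \<open>S\<close> this is the class \<open>C\<^sup>k\<close>: on a finite-dimensional domain, continuity of
  all iterated directional derivatives is continuity of the iterated Frechet derivatives.\<close>

fun C_k_on :: "nat \<Rightarrow> ('a::euclidean_space \<Rightarrow> 'b::real_normed_vector) \<Rightarrow> 'a set \<Rightarrow> bool" where
  "C_k_on 0 f S \<longleftrightarrow> continuous_on S f"
| "C_k_on (Suc k) f S \<longleftrightarrow> (\<forall>x\<in>S. f differentiable (at x)) \<and>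
     (\<forall>v. C_k_on k (\<lambda>x. frechet_derivative f (at x) v) S)"

definition smooth_on :: "('a::euclidean_space \<Rightarrow> 'b::real_normed_vector) \<Rightarrow> 'a set \<Rightarrow> bool" where
  "smooth_on f S \<longleftrightarrow> (\<forall>k. C_k_on k f S)"

text \<open>For smooth \<open>f\<close>: the Taylor expansion at the origin has no terms of degree less than 2.\<close>

definition at_least_quadratic ::
    "('a::real_normed_vector \<Rightarrow> 'b::real_normed_vector) \<Rightarrow> bool" where
  "at_least_quadratic f \<longleftrightarrow> f 0 = 0 \<and> (f has_derivative (\<lambda>_. 0)) (at 0)"

definition multipliers :: "real^'n^'n \<Rightarrow> complex set" where
  "multipliers A = {l. \<exists>v. v \<noteq> 0 \<and> map_matrix complex_of_real A *v v = l *s v}"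

definition full_map ::
    "real^'m^'m \<Rightarrow> real^'k^'k \<Rightarrow> ((real^'m) \<times> (real^'k) \<Rightarrow> real^'m) \<Rightarrow>
     ((real^'m) \<times> (real^'k) \<Rightarrow> real^'k) \<Rightarrow> (real^'m) \<times> (real^'k) \<Rightarrow> (real^'m) \<times> (real^'k)" where
  "full_map B C g h = (\<lambda>(u, v). (B *v u + g (u, v), C *v v + h (u, v)))"

definition reduced_map ::
    "real^'m^'m \<Rightarrow> ((real^'m) \<times> (real^'k) \<Rightarrow> real^'m) \<Rightarrow> (real^'m \<Rightarrow> real^'k) \<Rightarrow>
     real^'m \<Rightarrow> real^'m" where
  "reduced_map B g V = (\<lambda>u. B *v u + g (u, V u))"

text \<open>The graph of \<open>V\<close> over the neighbourhood \<open>U\<close> of the origin is locally invariant under \<open>F\<close>: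
  a point of it whose image still lies over \<open>U\<close> is mapped to the graph. The growth condition is
  taken along \<open>nhds 0\<close>, which includes the point \<open>0\<close>, so it forces \<open>V 0 = 0\<close>.\<close>

definition center_manifold_graph ::
    "((real^'m) \<times> (real^'k) \<Rightarrow> (real^'m) \<times> (real^'k)) \<Rightarrow> (real^'m \<Rightarrow> real^'k) \<Rightarrow>
     (real^'m) set \<Rightarrow> bool" where
  "center_manifold_graph F V U \<longleftrightarrow>
     open U \<and> 0 \<in> U \<and>
     (\<lambda>u. norm (V u)) \<in> O[nhds 0](\<lambda>u. (norm u)\<^sup>2) \<and>
     (\<forall>u\<in>U. fst (F (u, V u)) \<in> U \<longrightarrow> snd (F (u, V u)) = V (fst (F (u, V u))))"

definition is_orbit :: "('a \<Rightarrow> 'a) \<Rightarrow> (nat \<Rightarrow> 'a) \<Rightarrow> bool" where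
  "is_orbit F x \<longleftrightarrow> (\<forall>n. x (Suc n) = F (x n))"

end

theory Submission
  imports Defs
begin

text \<open>
  Near a bounded set \<open>A\<close> the \<open>C\<^sup>1\<close> map \<open>V\<close> is \<open>L\<close>-Lipschitz, so the \<open>\<epsilon>\<close>-neighbourhood of the graph
  \<open>G\<close> of \<open>V\<close> over \<open>A\<close> lies inside the tube of points \<open>(x, y)\<close> with \<open>x \<in> A\<^sub>\<epsilon>\<close> and
  \<open>\<bar>y - V x\<bar> < (1 + L) \<epsilon>\<close>, while the \<open>(2 + L) \<epsilon>\<close>-neighbourhood of \<open>G\<close> contains the tube with
  \<open>\<bar>y - V x\<bar> < \<epsilon>\<close>. By Fubini the volume of a tube is \<open>\<bar>A\<^sub>\<epsilon>\<bar>\<close> times that of a ball in the fibre,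
  whose order \<open>\<epsilon>\<^sup>k\<close> is compensated by the change of the ambient dimension. Hence the Minkowski
  contents of \<open>A\<close> and of \<open>G\<close> vanish for the same exponents \<open>s\<close>.
\<close>

section \<open>Volumes of neighbourhoods of a set and of a graph over it\<close>

lemma eps_nbhd_eq_UN_ball: "eps_nbhd A \<epsilon> = (\<Union>a\<in>A. ball a \<epsilon>)"
proof (cases "A = {}")
  case False
  have "infdist y A < \<epsilon> \<longleftrightarrow> (\<exists>a\<in>A. dist y a < \<epsilon>)" for y
    using False by (simp add: infdist_def cInf_less_iff bdd_below_image_dist)
  then show ?thesis
    using False by (auto simp: eps_nbhd_def dist_commute)
qed (simp add: eps_nbhd_def)

lemma open_eps_nbhd: "open (eps_nbhd A \<epsilon>)"
  by (auto simp: eps_nbhd_eq_UN_ball)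

lemma mem_eps_nbhd: "y \<in> eps_nbhd A \<epsilon> \<longleftrightarrow> (\<exists>a\<in>A. dist y a < \<epsilon>)"
  by (auto simp: eps_nbhd_eq_UN_ball dist_commute)

lemma emeasure_lborel_prod_open:
  fixes S :: "('a::euclidean_space \<times> 'b::euclidean_space) set"
  assumes "open S"
  shows "emeasure lborel S = (\<integral>\<^sup>+x. emeasure lborel (Pair x -` S) \<partial>lborel)"
proof -
  have "S \<in> sets (lborel \<Otimes>\<^sub>M lborel)"
    using assms by (simp only: lborel_prod sets_lborel borel_open)
  then have "emeasure (lborel \<Otimes>\<^sub>M lborel) S = (\<integral>\<^sup>+x. emeasure lborel (Pair x -` S) \<partial>lborel)"
    by (rule lborel.emeasure_pair_measure_alt)
  then show ?thesis
    by (simp add: lborel_prod)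
qed

text \<open>Upper half of the tube comparison: each fibre of the neighbourhood fits into one ball,
  whose radius does not depend on the base point.\<close>

lemma emeasure_eps_nbhd_graph_le:
  fixes A :: "'a::euclidean_space set" and V :: "'a \<Rightarrow> 'b::euclidean_space"
  assumes lip: "L-lipschitz_on (eps_nbhd A \<delta>) V" and "0 < \<epsilon>" "\<epsilon> \<le> \<delta>"
  shows "emeasure lborel (eps_nbhd ((\<lambda>a. (a, V a)) ` A) \<epsilon>)
    \<le> ennreal (unit_ball_vol DIM('b) * ((1 + L) * \<epsilon>) ^ DIM('b)) * emeasure lborel (eps_nbhd A \<epsilon>)"
    (is "emeasure lborel ?G \<le> ?c * _")
proof -
  have L: "0 \<le> L"
    using lip by (rule lipschitz_on_nonneg)
  \<comment> \<open>Different points \<open>a\<close> may account for different \<open>y\<close> in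
    the fibre over \<open>x\<close>. Recentring from \<open>V a\<close> to \<open>V x\<close> costs
    at most \<open>L * \<epsilon>\<close>, so a single ball of radius
    \<open>(1 + L) * \<epsilon>\<close> serves them all; \<open>\<epsilon> \<le> \<delta>\<close>
    keeps \<open>x\<close> where \<open>V\<close> is Lipschitz.\<close>
  have slice: "Pair x -` ?G \<subseteq> (if x \<in> eps_nbhd A \<epsilon> then ball (V x) ((1 + L) * \<epsilon>) else {})" for x
  proof
    fix y assume "y \<in> Pair x -` ?G"
    then obtain a where a: "a \<in> A" "dist (x, y) (a, V a) < \<epsilon>"
      by (auto simp: mem_eps_nbhd)
    have xa: "dist x a < \<epsilon>" and ya: "dist y (V a) < \<epsilon>"
      using a(2) dist_fst_le[of "(x, y)" "(a, V a)"] dist_snd_le[of "(x, y)" "(a, V a)"] by auto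
    have "x \<in> eps_nbhd A \<delta>" "a \<in> eps_nbhd A \<delta>"
      using a(1) xa assms(2,3) by (force simp: mem_eps_nbhd)+
    then have "dist (V x) (V a) \<le> L * dist x a"
      by (rule lipschitz_onD[OF lip])
    also have "\<dots> \<le> L * \<epsilon>"
      using xa L by (intro mult_left_mono) auto
    finally have "dist (V x) y < (1 + L) * \<epsilon>"
      using ya dist_triangle[of "V x" y "V a"] by (simp add: dist_commute algebra_simps)
    moreover have "x \<in> eps_nbhd A \<epsilon>"
      using a(1) xa by (auto simp: mem_eps_nbhd)
    ultimately show "y \<in> (if x \<in> eps_nbhd A \<epsilon> then ball (V x) ((1 + L) * \<epsilon>) else {})"
      by simp
  qed
  have "emeasure lborel ?G = (\<integral>\<^sup>+x. emeasure lborel (Pair x -` ?G) \<partial>lborel)"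
    by (intro emeasure_lborel_prod_open open_eps_nbhd)
  also have "\<dots> \<le> (\<integral>\<^sup>+x. ?c * indicator (eps_nbhd A \<epsilon>) x \<partial>lborel)"
  proof (rule nn_integral_mono)
    fix x
    have "emeasure lborel (Pair x -` ?G)
      \<le> emeasure lborel (if x \<in> eps_nbhd A \<epsilon> then ball (V x) ((1 + L) * \<epsilon>) else {})"
      by (rule emeasure_mono[OF slice]) auto
    also have "\<dots> = ?c * indicator (eps_nbhd A \<epsilon>) x"
      using L \<open>0 < \<epsilon>\<close> by (auto simp: emeasure_ball)
    finally show "emeasure lborel (Pair x -` ?G) \<le> ?c * indicator (eps_nbhd A \<epsilon>) x" .
  qed
  also have "\<dots> = ?c * emeasure lborel (eps_nbhd A \<epsilon>)"
    by (rule nn_integral_cmult_indicator) (simp add: open_eps_nbhd)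
  finally show ?thesis .
qed

text \<open>Lower half: the tube of fibre radius \<open>\<epsilon>\<close> lies in a larger
  neighbourhood of the graph. The factor \<open>2 + L\<close> adds the base offset, below
  \<open>\<epsilon>\<close>, to the fibre offset, below \<open>(1 + L) * \<epsilon>\<close>.\<close>

lemma emeasure_eps_nbhd_graph_ge:
  fixes A :: "'a::euclidean_space set" and V :: "'a \<Rightarrow> 'b::euclidean_space"
  assumes lip: "L-lipschitz_on (eps_nbhd A \<delta>) V" and "0 < \<epsilon>" "\<epsilon> \<le> \<delta>"
  shows "ennreal (unit_ball_vol DIM('b) * \<epsilon> ^ DIM('b)) * emeasure lborel (eps_nbhd A \<epsilon>)
    \<le> emeasure lborel (eps_nbhd ((\<lambda>a. (a, V a)) ` A) ((2 + L) * \<epsilon>))"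
    (is "?c * _ \<le> emeasure lborel ?G")
proof -
  have L: "0 \<le> L"
    using lip by (rule lipschitz_on_nonneg)
  have slice: "ball (V x) \<epsilon> \<subseteq> Pair x -` ?G" if "x \<in> eps_nbhd A \<epsilon>" for x
  proof
    fix y assume y: "y \<in> ball (V x) \<epsilon>"
    obtain a where a: "a \<in> A" and xa: "dist x a < \<epsilon>"
      using \<open>x \<in> eps_nbhd A \<epsilon>\<close> by (auto simp: mem_eps_nbhd)
    have "x \<in> eps_nbhd A \<delta>" "a \<in> eps_nbhd A \<delta>"
      using a xa assms(2,3) by (force simp: mem_eps_nbhd)+
    then have "dist (V x) (V a) \<le> L * dist x a"
      by (rule lipschitz_onD[OF lip])
    also have "\<dots> \<le> L * \<epsilon>"
      using xa L by (intro mult_left_mono) auto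
    finally have "dist y (V a) < (1 + L) * \<epsilon>"
      using y dist_triangle[of y "V a" "V x"] by (simp add: dist_commute algebra_simps)
    moreover have "dist (x, y) (a, V a) \<le> dist x a + dist y (V a)"
      by (simp add: dist_Pair_Pair sqrt_sum_squares_le_sum)
    ultimately have "dist (x, y) (a, V a) < (2 + L) * \<epsilon>"
      using xa by (simp add: algebra_simps)
    then show "y \<in> Pair x -` ?G"
      using a by (auto simp: mem_eps_nbhd)
  qed
  have "?c * emeasure lborel (eps_nbhd A \<epsilon>) = (\<integral>\<^sup>+x. ?c * indicator (eps_nbhd A \<epsilon>) x \<partial>lborel)"
    by (rule nn_integral_cmult_indicator[symmetric]) (simp add: open_eps_nbhd)
  also have "\<dots> \<le> (\<integral>\<^sup>+x. emeasure lborel (Pair x -` ?G) \<partial>lborel)"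
  proof (rule nn_integral_mono)
    fix x :: 'a
    \<comment> \<open>Openness makes the fibre measurable, as monotonicity of the measure requires
      of the larger set.\<close>
    have "open (Pair x -` ?G)"
      by (intro open_vimage open_eps_nbhd continuous_intros)
    then have "emeasure lborel (ball (V x) \<epsilon>) \<le> emeasure lborel (Pair x -` ?G)"
      if "x \<in> eps_nbhd A \<epsilon>"
      using slice[OF that] by (intro emeasure_mono) auto
    then show "?c * indicator (eps_nbhd A \<epsilon>) x \<le> emeasure lborel (Pair x -` ?G)"
      using \<open>0 < \<epsilon>\<close> by (auto simp: emeasure_ball indicator_def)
  qed
  also have "\<dots> = emeasure lborel ?G"
    by (intro emeasure_lborel_prod_open[symmetric] open_eps_nbhd)
  finally show ?thesis .
qed

section \<open>Comparison of Minkowski contents\<close>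

lemma Liminf_cmult_ennreal:
  fixes f :: "'a \<Rightarrow> ennreal"
  assumes "F \<noteq> bot" "c \<noteq> top"
  shows "Liminf F (\<lambda>x. c * f x) = c * Liminf F f"
  \<comment> \<open>Multiplication by \<open>c\<close> is monotone, and finiteness of
    \<open>c\<close> makes it continuous on \<open>ennreal\<close>, so it commutes with the lower
    limit.\<close>
  using assms
  by (intro Liminf_compose_continuous_mono)
    (auto simp: mono_def mult_left_mono less_top intro!: ennreal_continuous_on_cmult continuous_on_id)

lemma Limsup_cmult_ennreal:
  fixes f :: "'a \<Rightarrow> ennreal"
  assumes "F \<noteq> bot" "c \<noteq> top"
  shows "Limsup F (\<lambda>x. c * f x) = c * Limsup F f"
  using assms
  by (intro Limsup_compose_continuous_mono)
    (auto simp: mono_def mult_left_mono less_top intro!: ennreal_continuous_on_cmult continuous_on_id)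

text \<open>Multiplication by \<open>K > 0\<close> maps the filter \<open>at_right 0\<close> onto
  itself. This absorbs the enlarged radius \<open>(2 + L) * \<epsilon>\<close> of the lower volume
  estimate.\<close>

lemma
  fixes f :: "real \<Rightarrow> 'a::complete_lattice"
  assumes "0 < K"
  shows Liminf_at_right_0_scale: "Liminf (at_right 0) (\<lambda>x. f (K * x)) = Liminf (at_right 0) f"
    and Limsup_at_right_0_scale: "Limsup (at_right 0) (\<lambda>x. f (K * x)) = Limsup (at_right 0) f"
proof -
  have "inj ((*) K)"
    using assms by (auto intro: injI)
  moreover have "filtermap ((*) K) (at_right 0) = at_right 0"
    using filtermap_times_pos_at_right[OF assms, of 0] by simp
  ultimately show "Liminf (at_right 0) (\<lambda>x. f (K * x)) = Liminf (at_right 0) f"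
    "Limsup (at_right 0) (\<lambda>x. f (K * x)) = Limsup (at_right 0) f"
    using Liminf_filtermap_eq[of "(*) K" "at_right 0" f]
      Limsup_filtermap_eq[of "(*) K" "at_right 0" f] by simp_all
qed

text \<open>The volume quotients of \<open>A\<close> and \<open>G\<close> bound each other up to
  finite constants and a rescaling of \<open>\<epsilon>\<close>. The contents themselves may differ,
  but their vanishing, which is all that the dimensions see, is preserved.\<close>

lemma
  fixes A :: "'a::euclidean_space set" and V :: "'a \<Rightarrow> 'b::euclidean_space"
  assumes lip: "L-lipschitz_on (eps_nbhd A \<delta>) V" and "0 < \<delta>"
  defines "G \<equiv> (\<lambda>a. (a, V a)) ` A"
  shows lower_minkowski_content_graph_eq_0_iff:
      "lower_minkowski_content s G = 0 \<longleftrightarrow> lower_minkowski_content s A = 0" (is ?lower)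
    and upper_minkowski_content_graph_eq_0_iff:
      "upper_minkowski_content s G = 0 \<longleftrightarrow> upper_minkowski_content s A = 0" (is ?upper)
proof -
  define b where "b = DIM('b)"
  define \<beta> where "\<beta> = unit_ball_vol b"
  define K where "K = 2 + L"
  define \<phi> where "\<phi> \<epsilon> = emeasure lebesgue (eps_nbhd A \<epsilon>) / ennreal (\<epsilon> powr (real DIM('a) - s))" for \<epsilon>
  define \<gamma> where
    "\<gamma> \<epsilon> = emeasure lebesgue (eps_nbhd G \<epsilon>) / ennreal (\<epsilon> powr (real DIM('a \<times> 'b) - s))" for \<epsilon>
  \<comment> \<open>\<open>c1\<close> is the volume of the fibre ball of radius
    \<open>(1 + L) * \<epsilon>\<close> without its factor \<open>\<epsilon> ^ b\<close>. In
    \<open>c2\<close> the power of \<open>K\<close> comes from evaluating the denominator of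
    \<open>\<gamma>\<close> at \<open>K * \<epsilon>\<close>, and \<open>\<beta>\<close> from the
    fibre ball of radius \<open>\<epsilon>\<close>.\<close>
  define c1 where "c1 = ennreal (\<beta> * (1 + L) ^ b)"
  define c2 where "c2 = ennreal (K powr (real DIM('a \<times> 'b) - s) / \<beta>)"
  have L: "0 \<le> L"
    using lip by (rule lipschitz_on_nonneg)
  have "0 < \<beta>"
    by (simp add: \<beta>_def)
  have "0 < K"
    using L by (simp add: K_def)
  \<comment> \<open>The extra \<open>b\<close> ambient dimensions contribute exactly the factor
    \<open>\<epsilon> ^ b\<close> that cancels against the fibre volume, so \<open>s\<close> stays
    the same.\<close>
  have powr_split: "\<epsilon> powr (real DIM('a \<times> 'b) - s) = \<epsilon> ^ b * \<epsilon> powr (real DIM('a) - s)"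
    if "0 < \<epsilon>" for \<epsilon>
    using that by (simp add: b_def flip: powr_realpow powr_add) (simp add: algebra_simps)
  \<comment> \<open>Quotients in \<open>ennreal\<close> become products with real coefficients, so
    that \<open>assoc\<close> can merge the constants and leave the cancellation to real
    arithmetic.\<close>
  have div: "x / ennreal p = ennreal (1 / p) * x" if "0 < p" for x p
    using that by (simp add: divide_ennreal_def inverse_ennreal inverse_eq_divide mult.commute)
  have assoc: "ennreal p * (ennreal q * x) = ennreal (p * q) * x" if "0 \<le> p" "0 \<le> q" for p q x
    using that by (simp add: ennreal_mult mult.assoc)
  have small: "\<forall>\<^sub>F \<epsilon> in at_right 0. 0 < \<epsilon> \<and> \<epsilon> \<le> \<delta>"
    using \<open>0 < \<delta>\<close> by (auto simp: eventually_at_right_field intro!: exI[of _ \<delta>])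
  have le1: "\<gamma> \<epsilon> \<le> c1 * \<phi> \<epsilon>" if "0 < \<epsilon>" "\<epsilon> \<le> \<delta>" for \<epsilon>
  proof -
    let ?p = "\<epsilon> powr (real DIM('a) - s)"
    have "\<gamma> \<epsilon> = ennreal (1 / (\<epsilon> ^ b * ?p)) * emeasure lborel (eps_nbhd G \<epsilon>)"
      using that by (simp only: \<gamma>_def powr_split div) (simp add: div open_eps_nbhd)
    also have "\<dots> \<le> ennreal (1 / (\<epsilon> ^ b * ?p)) *
        (ennreal (\<beta> * ((1 + L) * \<epsilon>) ^ b) * emeasure lborel (eps_nbhd A \<epsilon>))"
      using emeasure_eps_nbhd_graph_le[OF lip that]
      by (intro mult_left_mono) (simp_all add: G_def \<beta>_def b_def)
    also have "\<dots> = ennreal (\<beta> * (1 + L) ^ b * (1 / ?p)) * emeasure lborel (eps_nbhd A \<epsilon>)"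
      using that L \<open>0 < \<beta>\<close> by (subst assoc) (auto simp: power_mult_distrib)
    also have "\<dots> = c1 * (ennreal (1 / ?p) * emeasure lborel (eps_nbhd A \<epsilon>))"
      unfolding c1_def using that L \<open>0 < \<beta>\<close> by (subst assoc) auto
    also have "\<dots> = c1 * \<phi> \<epsilon>"
      using that by (simp add: \<phi>_def div open_eps_nbhd)
    finally show ?thesis .
  qed
  have le2: "\<phi> \<epsilon> \<le> c2 * \<gamma> (K * \<epsilon>)" if "0 < \<epsilon>" "\<epsilon> \<le> \<delta>" for \<epsilon>
  proof -
    let ?p = "\<epsilon> powr (real DIM('a) - s)" and ?k = "K powr (real DIM('a \<times> 'b) - s)"
    have "\<phi> \<epsilon> = ennreal (1 / ?p) * emeasure lborel (eps_nbhd A \<epsilon>)"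
      using that by (simp add: \<phi>_def div open_eps_nbhd)
    also have "\<dots> = ennreal (1 / (\<beta> * (\<epsilon> ^ b * ?p))) *
        (ennreal (\<beta> * \<epsilon> ^ b) * emeasure lborel (eps_nbhd A \<epsilon>))"
      using that \<open>0 < \<beta>\<close> by (subst assoc) auto
    also have "\<dots> \<le> ennreal (1 / (\<beta> * (\<epsilon> ^ b * ?p))) * emeasure lborel (eps_nbhd G (K * \<epsilon>))"
      using emeasure_eps_nbhd_graph_ge[OF lip that]
      by (intro mult_left_mono) (simp_all add: G_def \<beta>_def b_def K_def)
    also have "\<dots> = ennreal (?k / \<beta> * (1 / (?k * (\<epsilon> ^ b * ?p)))) * emeasure lborel (eps_nbhd G (K * \<epsilon>))"
      using that \<open>0 < \<beta>\<close> \<open>0 < K\<close> by (simp add: field_simps)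
    also have "\<dots> = c2 * (ennreal (1 / (?k * (\<epsilon> ^ b * ?p))) * emeasure lborel (eps_nbhd G (K * \<epsilon>)))"
      unfolding c2_def using that \<open>0 < \<beta>\<close> \<open>0 < K\<close> by (subst assoc) auto
    also have "\<dots> = c2 * \<gamma> (K * \<epsilon>)"
    proof -
      have "(K * \<epsilon>) powr (real DIM('a \<times> 'b) - s) = ?k * (\<epsilon> ^ b * ?p)"
        using that \<open>0 < K\<close> by (simp only: powr_mult powr_split less_imp_le)
      then show ?thesis
        using that \<open>0 < K\<close> by (simp only: \<gamma>_def) (simp add: div open_eps_nbhd)
    qed
    finally show ?thesis .
  qed
  have fin: "c1 \<noteq> top" "c2 \<noteq> top"
    by (simp_all add: c1_def c2_def)
  have ev1: "\<forall>\<^sub>F \<epsilon> in at_right 0. \<gamma> \<epsilon> \<le> c1 * \<phi> \<epsilon>"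
    and ev2: "\<forall>\<^sub>F \<epsilon> in at_right 0. \<phi> \<epsilon> \<le> c2 * \<gamma> (K * \<epsilon>)"
    using small by (auto elim!: eventually_mono intro: le1 le2)
  have "Liminf (at_right 0) \<gamma> \<le> c1 * Liminf (at_right 0) \<phi>"
    using Liminf_mono[OF ev1] fin by (simp add: Liminf_cmult_ennreal)
  moreover have "Liminf (at_right 0) \<phi> \<le> c2 * Liminf (at_right 0) \<gamma>"
    using Liminf_mono[OF ev2] fin \<open>0 < K\<close>
    by (simp add: Liminf_cmult_ennreal Liminf_at_right_0_scale[of K \<gamma>])
  \<comment> \<open>If either lower limit is 0, a finite multiple of it, hence also the other one,
    is 0.\<close>
  ultimately show ?lower
    unfolding lower_minkowski_content_def \<phi>_def[symmetric] \<gamma>_def[symmetric] by auto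
  have "Limsup (at_right 0) \<gamma> \<le> c1 * Limsup (at_right 0) \<phi>"
    using Limsup_mono[OF ev1] fin by (simp add: Limsup_cmult_ennreal)
  moreover have "Limsup (at_right 0) \<phi> \<le> c2 * Limsup (at_right 0) \<gamma>"
    using Limsup_mono[OF ev2] fin \<open>0 < K\<close>
    by (simp add: Limsup_cmult_ennreal Limsup_at_right_0_scale[of K \<gamma>])
  ultimately show ?upper
    unfolding upper_minkowski_content_def \<phi>_def[symmetric] \<gamma>_def[symmetric] by auto
qed

section \<open>Lipschitz bounds for \<open>C_k_on\<close> maps\<close>

lemma C_k_on_imp_continuous_on:
  assumes "C_k_on k f S"
  shows "continuous_on S f"
proof (cases k)
  case 0
  then show ?thesis
    using assms by simp
next
  case (Suc j)
  have "isCont f x" if "x \<in> S" for x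
  proof (rule differentiable_imp_continuous_within)
    show "f differentiable (at x)"
      using assms that unfolding Suc C_k_on.simps by blast
  qed
  then show ?thesis
    by (intro continuous_at_imp_continuous_on ballI)
qed

text \<open>Compactness bounds the derivative, and convexity then gives the Lipschitz estimate by
  the mean value inequality.\<close>

lemma C_k_on_imp_lipschitz_on:
  fixes f :: "'a::euclidean_space \<Rightarrow> 'b::real_normed_vector"
  assumes f: "C_k_on k f S" and "1 \<le> k" and X: "compact X" "convex X" "X \<subseteq> S"
  obtains L where "L-lipschitz_on X f"
proof -
  let ?D = "\<lambda>x. frechet_derivative f (at x)"
  obtain j where j: "k = Suc j"
    using \<open>1 \<le> k\<close> by (cases k) auto
  have der: "(f has_derivative ?D x) (at x)" if "x \<in> X" for x
    using f X(3) that by (auto simp: j simp flip: frechet_derivative_works)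
  have "continuous_on X (\<lambda>x. ?D x v)" for v
  proof (rule continuous_on_subset[OF C_k_on_imp_continuous_on X(3)])
    show "C_k_on j (\<lambda>x. ?D x v) S"
      using f unfolding j C_k_on.simps by blast
  qed
  \<comment> \<open>\<open>C_k_on\<close> supplies continuity only for each fixed direction. The sum
    over the finite basis is therefore used as a continuous function dominating the operator
    norm.\<close>
  then have "continuous_on X (\<lambda>x. \<Sum>i\<in>Basis. norm (?D x i))"
    by (intro continuous_intros)
  then have "bounded ((\<lambda>x. \<Sum>i\<in>Basis. norm (?D x i)) ` X)"
    using X(1) by (intro compact_imp_bounded compact_continuous_image)
  then obtain M where "0 < M" and M: "\<And>x. x \<in> X \<Longrightarrow> \<bar>\<Sum>i\<in>Basis. norm (?D x i)\<bar> \<le> M"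
    by (auto simp: bounded_pos)
  have "M-lipschitz_on X f"
  proof (rule bounded_derivative_imp_lipschitz)
    fix x assume x: "x \<in> X"
    show "(f has_derivative ?D x) (at x within X)"
      by (rule has_derivative_at_withinI[OF der[OF x]])
    interpret D: bounded_linear "?D x"
      by (rule has_derivative_bounded_linear[OF der[OF x]])
    show "onorm (?D x) \<le> M"
    proof (rule onorm_le)
      fix v
      have "norm (?D x v) = norm (\<Sum>i\<in>Basis. (v \<bullet> i) *\<^sub>R ?D x i)"
        by (subst euclidean_representation[of v, symmetric]) (simp only: D.sum D.scaleR)
      also have "\<dots> \<le> (\<Sum>i\<in>Basis. norm v * norm (?D x i))"
        by (intro sum_norm_le) (auto intro!: mult_right_mono simp: Basis_le_norm)
      also have "\<dots> = (\<Sum>i\<in>Basis. norm (?D x i)) * norm v"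
        by (simp add: sum_distrib_left mult.commute)
      also have "\<dots> \<le> M * norm v"
        using M[OF x] by (intro mult_right_mono) auto
      finally show "norm (?D x v) \<le> M * norm v" .
    qed
  qed (use X \<open>0 < M\<close> in auto)
  then show thesis
    by (rule that)
qed

section \<open>Box dimension of the graph and orbits on the center manifold\<close>

lemma has_box_dim_graph:
  fixes A :: "'a::euclidean_space set" and V :: "'a \<Rightarrow> 'b::euclidean_space"
  assumes "C_k_on k V UNIV" "1 \<le> k" and A: "has_box_dim A d"
  shows "has_box_dim ((\<lambda>a. (a, V a)) ` A) d"
proof -
  have bdd: "bounded A"
    using A by (simp add: has_box_dim_def)
  then obtain R where R: "\<And>a. a \<in> A \<Longrightarrow> norm a \<le> R"
    by (auto simp: bounded_iff)
  \<comment> \<open>The neighbourhood need be neither convex nor compact, so the Lipschitz constant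
    is taken on a closed ball around it. Any positive \<open>\<delta>\<close> would do; here it is
    1.\<close>
  have sub: "eps_nbhd A 1 \<subseteq> cball 0 (R + 1)"
  proof
    fix x assume "x \<in> eps_nbhd A 1"
    then obtain a where "a \<in> A" "dist x a < 1"
      by (auto simp: mem_eps_nbhd)
    then show "x \<in> cball 0 (R + 1)"
      using R[of a] norm_triangle_sub[of x a] by (simp add: dist_norm)
  qed
  obtain L where "L-lipschitz_on (cball 0 (R + 1)) V"
    using C_k_on_imp_lipschitz_on[OF assms(1,2) compact_cball convex_cball subset_UNIV] .
  then have lip: "L-lipschitz_on (eps_nbhd A 1) V"
    using sub by (rule lipschitz_on_subset)
  have "compact ((\<lambda>a. (a, V a)) ` closure A)"
    using bdd C_k_on_imp_continuous_on[OF assms(1)]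
    by (intro compact_continuous_image continuous_intros)
      (auto simp: compact_closure intro: continuous_on_subset)
  then have "bounded ((\<lambda>a. (a, V a)) ` A)"
    by (rule bounded_subset[OF compact_imp_bounded]) (intro image_mono closure_subset)
  \<comment> \<open>The contents vanish for the same \<open>s\<close>, so the infima defining the
    dimensions range over the same sets.\<close>
  then show ?thesis
    using A lower_minkowski_content_graph_eq_0_iff[OF lip]
      upper_minkowski_content_graph_eq_0_iff[OF lip]
    by (simp add: has_box_dim_def lower_box_dim_def upper_box_dim_def)
qed

text \<open>Over the graph the first component of the full map is the reduced map. As
  \<open>u (Suc n)\<close> again lies in \<open>U\<close>, local invariance applies at every step
  and determines the second component.\<close>

lemma is_orbit_center_manifold:
  assumes graph: "center_manifold_graph (full_map B C g h) V U"
    and orbit: "is_orbit (reduced_map B g V) u" and "range u \<subseteq> U"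
  shows "is_orbit (full_map B C g h) (\<lambda>n. (u n, V (u n)))"
  unfolding is_orbit_def
proof
  fix n
  let ?F = "full_map B C g h"
  have fst: "fst (?F (u n, V (u n))) = u (Suc n)"
    using orbit by (simp add: full_map_def is_orbit_def reduced_map_def)
  moreover have "snd (?F (u n, V (u n))) = V (u (Suc n))"
    using graph \<open>range u \<subseteq> U\<close> fst unfolding center_manifold_graph_def
    by (metis rangeI subsetD)
  ultimately show "(u (Suc n), V (u (Suc n))) = ?F (u n, V (u n))"
    by (simp add: prod_eq_iff)
qed

theorem theorem9:
  fixes B :: "real^'m^'m" and C :: "real^'k^'k"
    and g :: "(real^'m) \<times> (real^'k) \<Rightarrow> real^'m"
    and h :: "(real^'m) \<times> (real^'k) \<Rightarrow> real^'k"
    and V :: "real^'m \<Rightarrow> real^'k" and U :: "(real^'m) set"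
    and r :: nat and u :: "nat \<Rightarrow> real^'m" and D :: real
  assumes "\<forall>l\<in>multipliers B. cmod l = 1"
    and "\<forall>l\<in>multipliers C. cmod l < 1"
    and "smooth_on g UNIV" and "at_least_quadratic g"
    and "smooth_on h UNIV" and "at_least_quadratic h"
    and "r \<ge> 1" and "C_k_on r V UNIV"
    and "center_manifold_graph (full_map B C g h) V U"
    and "is_orbit (reduced_map B g V) u"
    and "range u \<subseteq> U" and "bounded (range u)"
    and "has_box_dim (range u) D"
  shows "is_orbit (full_map B C g h) (\<lambda>n. (u n, V (u n))) \<and>
    has_box_dim (range (\<lambda>n. (u n, V (u n)))) D"
proof
  show "is_orbit (full_map B C g h) (\<lambda>n. (u n, V (u n)))"
    using assms(9-11) by (rule is_orbit_center_manifold)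
  \<comment> \<open>As a set of points, the full orbit is the graph of \<open>V\<close> over
    \<open>range u\<close>.\<close>
  have "has_box_dim ((\<lambda>a. (a, V a)) ` range u) D"
    using assms(8,7,13) by (rule has_box_dim_graph)
  then show "has_box_dim (range (\<lambda>n. (u n, V (u n)))) D"
    by (simp add: image_image)
qed

end
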